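(* Let $\mathfrak g$ be a finite-dimensional real Lie algebra with a positive definite invariant inner product and an orthogonal involutive automorphism $\sigma$. For every $Z\in\mathfrak g$, the quantity $\mathcal H_8(\sigma,Z)$ is nonnegative, and it vanishes if and only if $$\dim\operatorname{Lie}\{Z,\sigma Z\}\le3.$$ If $C=0$, then $\operatorname{Lie}\{Z,\sigma Z\}$ is the abelian span of $A_+,A_-$. If $C\neq0$ and $\mathcal H_8(\sigma,Z)=0$, then $\operatorname{Lie}\{Z,\sigma Z\}=\operatorname{span}\{A_+,A_-,C\}\cong\mathfrak{su}(2)$.
   Context: An inner product on a real Lie algebra is invariant if $\langle[X,Y],Z\rangle=\langle X,[Y,Z]\rangle$ for all $X,Y,Z$. $\operatorname{Lie}\{U,W\}$ is the smallest real Lie subalgebra containing $U,W$. For $Z\in\mathfrak g$ put $A_\pm=\tfrac12(Z\pm\sigma Z)$, $C=[A_+,A_-]$, $C_+=[A_+,C]$, $C_-=[A_-,C]$, and, with $\|\cdot\|$ the norm of the given inner product, $$\mathcal H_8(\sigma,Z)=\|A_-\|^2\|C_+\|^2+\|A_+\|^2\|C_-\|^2-2\|C\|^4 .$$ *)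

theory Defs
  imports "HOL-Analysis.Analysis"
begin

definition lie_bracket :: "('a::real_vector \<Rightarrow> 'a \<Rightarrow> 'a) \<Rightarrow> bool" where
  "lie_bracket br \<longleftrightarrow> bilinear br \<and> (\<forall>x. br x x = 0) \<and>
     (\<forall>x y z. br x (br y z) + br y (br z x) + br z (br x y) = 0)"

(* The class euclidean_space would exclude the zero algebra. *)
definition finite_dimensional :: "'a::real_vector set \<Rightarrow> bool" where
  "finite_dimensional V \<longleftrightarrow> (\<exists>B. finite B \<and> V = span B)"

definition invariant_inner :: "('a::real_inner \<Rightarrow> 'a \<Rightarrow> 'a) \<Rightarrow> bool" where
  "invariant_inner br \<longleftrightarrow> (\<forall>x y z. br x y \<bullet> z = x \<bullet> br y z)"

definition lie_subalgebra :: "('a::real_vector \<Rightarrow> 'a \<Rightarrow> 'a) \<Rightarrow> 'a set \<Rightarrow> bool" where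
  "lie_subalgebra br S \<longleftrightarrow> subspace S \<and> (\<forall>x\<in>S. \<forall>y\<in>S. br x y \<in> S)"

definition lie_gen :: "('a::real_vector \<Rightarrow> 'a \<Rightarrow> 'a) \<Rightarrow> 'a set \<Rightarrow> 'a set" where
  "lie_gen br A = lie_subalgebra br hull A"

definition lie_abelian :: "('a::real_vector \<Rightarrow> 'a \<Rightarrow> 'a) \<Rightarrow> 'a set \<Rightarrow> bool" where
  "lie_abelian br S \<longleftrightarrow> (\<forall>x\<in>S. \<forall>y\<in>S. br x y = 0)"

definition lie_isomorphism ::
  "('a::real_vector \<Rightarrow> 'a \<Rightarrow> 'a) \<Rightarrow> 'a set \<Rightarrow> ('b::real_vector \<Rightarrow> 'b \<Rightarrow> 'b) \<Rightarrow> 'b set \<Rightarrow> ('a \<Rightarrow> 'b) \<Rightarrow> bool"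
  where
  "lie_isomorphism br S br' T f \<longleftrightarrow> bij_betw f S T \<and>
     (\<forall>x\<in>S. \<forall>y\<in>S. f (x + y) = f x + f y) \<and>
     (\<forall>c. \<forall>x\<in>S. f (c *\<^sub>R x) = c *\<^sub>R f x) \<and>
     (\<forall>x\<in>S. \<forall>y\<in>S. f (br x y) = br' (f x) (f y))"

definition lie_isomorphic ::
  "('a::real_vector \<Rightarrow> 'a \<Rightarrow> 'a) \<Rightarrow> 'a set \<Rightarrow> ('b::real_vector \<Rightarrow> 'b \<Rightarrow> 'b) \<Rightarrow> 'b set \<Rightarrow> bool"
  where
  "lie_isomorphic br S br' T \<longleftrightarrow> (\<exists>f. lie_isomorphism br S br' T f)"

definition commutator :: "complex^2^2 \<Rightarrow> complex^2^2 \<Rightarrow> complex^2^2" where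
  "commutator A B = A ** B - B ** A"

definition conj_transpose :: "complex^2^2 \<Rightarrow> complex^2^2" where
  "conj_transpose A = (\<chi> i j. cnj (A $ j $ i))"

definition su2 :: "(complex^2^2) set" where
  "su2 = {A. conj_transpose A = - A \<and> trace A = 0}"

definition A_plus :: "('a::real_vector \<Rightarrow> 'a) \<Rightarrow> 'a \<Rightarrow> 'a" where
  "A_plus \<sigma> Z = (1/2) *\<^sub>R (Z + \<sigma> Z)"

definition A_minus :: "('a::real_vector \<Rightarrow> 'a) \<Rightarrow> 'a \<Rightarrow> 'a" where
  "A_minus \<sigma> Z = (1/2) *\<^sub>R (Z - \<sigma> Z)"

definition C_mid :: "('a::real_vector \<Rightarrow> 'a \<Rightarrow> 'a) \<Rightarrow> ('a \<Rightarrow> 'a) \<Rightarrow> 'a \<Rightarrow> 'a" where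
  "C_mid br \<sigma> Z = br (A_plus \<sigma> Z) (A_minus \<sigma> Z)"

definition C_plus :: "('a::real_vector \<Rightarrow> 'a \<Rightarrow> 'a) \<Rightarrow> ('a \<Rightarrow> 'a) \<Rightarrow> 'a \<Rightarrow> 'a" where
  "C_plus br \<sigma> Z = br (A_plus \<sigma> Z) (C_mid br \<sigma> Z)"

definition C_minus :: "('a::real_vector \<Rightarrow> 'a \<Rightarrow> 'a) \<Rightarrow> ('a \<Rightarrow> 'a) \<Rightarrow> 'a \<Rightarrow> 'a" where
  "C_minus br \<sigma> Z = br (A_minus \<sigma> Z) (C_mid br \<sigma> Z)"

definition H8 :: "('a::real_inner \<Rightarrow> 'a \<Rightarrow> 'a) \<Rightarrow> ('a \<Rightarrow> 'a) \<Rightarrow> 'a \<Rightarrow> real" where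
  "H8 br \<sigma> Z = (norm (A_minus \<sigma> Z))\<^sup>2 * (norm (C_plus br \<sigma> Z))\<^sup>2
     + (norm (A_plus \<sigma> Z))\<^sup>2 * (norm (C_minus br \<sigma> Z))\<^sup>2
     - 2 * (norm (C_mid br \<sigma> Z)) ^ 4"

end

theory Submission
  imports Defs
begin

text \<open>
  Write \<open>a = A\<^sub>+\<close>, \<open>b = A\<^sub>-\<close>, \<open>c = [a,b]\<close>. Since \<open>\<sigma>\<close> is orthogonal, its eigenvectors \<open>a\<close> and
  \<open>b\<close> are orthogonal, and by invariance \<open>c\<close> is orthogonal to both, while
  \<open>\<langle>[a,c],b\<rangle> = -|c|\<^sup>2\<close> and \<open>\<langle>[b,c],a\<rangle> = |c|\<^sup>2\<close>. Hence \<open>\<H>\<^sub>8\<close> is the sum of the two Cauchy--Schwarz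
  defects of the pairs \<open>([a,c],b)\<close> and \<open>([b,c],a)\<close>. For \<open>c \<noteq> 0\<close> both defects vanish iff
  \<open>[a,c]\<close> is a multiple of \<open>b\<close> and \<open>[b,c]\<close> one of \<open>a\<close>, that is, iff the span of \<open>a, b, c\<close>
  is already a subalgebra; rescaling \<open>a, b, c\<close> then gives the structure constants of the cross
  product.
\<close>

section \<open>Linear algebra and generated subalgebras\<close>

lemma Cauchy_Schwarz_equality_imp:
  fixes x y :: "'a::real_inner"
  assumes "(x \<bullet> y)\<^sup>2 = (x \<bullet> x) * (y \<bullet> y)" "y \<noteq> 0"
  shows "x = (x \<bullet> y / (y \<bullet> y)) *\<^sub>R y"
proof -
  \<comment> \<open>Up to the factor \<open>y \<bullet> y\<close>, this is the component of
    \<open>x\<close> orthogonal to \<open>y\<close>; its squared norm is a multiple of the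
    Cauchy-Schwarz defect.\<close>
  let ?d = "(y \<bullet> y) *\<^sub>R x - (x \<bullet> y) *\<^sub>R y"
  have "?d \<bullet> ?d = (y \<bullet> y) * ((x \<bullet> x) * (y \<bullet> y) - (x \<bullet> y)\<^sup>2)"
    by (simp add: inner_diff_left inner_diff_right inner_commute algebra_simps power2_eq_square)
  then have "(y \<bullet> y) *\<^sub>R x = (x \<bullet> y) *\<^sub>R y"
    using assms(1) by simp
  then have "(1 / (y \<bullet> y)) *\<^sub>R (y \<bullet> y) *\<^sub>R x = (1 / (y \<bullet> y)) *\<^sub>R (x \<bullet> y) *\<^sub>R y"
    by simp
  then show ?thesis
    using assms(2) by simp
qed

text \<open>Reduces closure of a span under the bracket to finitely many checks on spanning vectors,
  extending by linearity in one argument at a time.\<close>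

lemma bilinear_span_closed:
  assumes br: "bilinear br"
    and B: "\<And>x y. x \<in> B \<Longrightarrow> y \<in> B \<Longrightarrow> br x y \<in> span B"
    and xy: "x \<in> span B" "y \<in> span B"
  shows "br x y \<in> span B"
proof -
  have 1: "br u v \<in> span B" if u: "u \<in> B" and v: "v \<in> span B" for u v
    using v
    by (induction rule: span_induct_alt)
      (auto simp: bilinear_rzero[OF br] bilinear_radd[OF br] bilinear_rmul[OF br]
        intro: span_add span_scale B u span_zero)
  show ?thesis
    using xy(1)
    by (induction rule: span_induct_alt)
      (auto simp: bilinear_lzero[OF br] bilinear_ladd[OF br] bilinear_lmul[OF br]
        intro: span_add span_scale 1 xy(2) span_zero)
qed

lemma lie_subalgebra_lie_gen: "lie_subalgebra br (lie_gen br A)"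
  unfolding lie_gen_def
  by (rule hull_in) (auto simp: lie_subalgebra_def intro: subspace_Inter)

lemma lie_gen_superset: "A \<subseteq> lie_gen br A"
  unfolding lie_gen_def by (rule hull_subset)

lemma lie_gen_minimal: "A \<subseteq> S \<Longrightarrow> lie_subalgebra br S \<Longrightarrow> lie_gen br A \<subseteq> S"
  unfolding lie_gen_def by (rule hull_minimal)

text \<open>Extend \<open>B\<close> to a basis of \<open>V\<close>. Finite dimension makes this
  basis finite, so that comparing cardinalities leaves no room for new vectors.\<close>

lemma independent_eq_span_of_dim_le:
  assumes fin: "finite_dimensional (UNIV :: 'a::real_vector set)"
    and V: "subspace (V :: 'a set)"
    and B: "independent B" "B \<subseteq> V" "dim V \<le> card B"
  shows "V = span B"
proof -
  obtain F :: "'a set" where F: "finite F" "span F = UNIV"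
    using fin by (auto simp: finite_dimensional_def)
  obtain B' where B': "B \<subseteq> B'" "B' \<subseteq> V" "independent B'" "V \<subseteq> span B'"
    using maximal_independent_subset_extend[OF B(2,1)] by blast
  have "finite B'"
    using independent_span_bound[OF F(1) B'(3)] F(2) by simp
  moreover have "dim V = card B'"
    using basis_card_eq_dim[OF B'(2,4,3)] by simp
  ultimately have "B = B'"
    using B(3) B'(1) by (metis card_seteq)
  then show ?thesis
    using B' V by (metis span_minimal subset_antisym)
qed

lemma span_three: "span {a, b, c} = {x *\<^sub>R a + y *\<^sub>R b + z *\<^sub>R c |x y z. True}"
proof -
  have "w - k *\<^sub>R a - l *\<^sub>R b = z *\<^sub>R c \<longleftrightarrow> w = k *\<^sub>R a + l *\<^sub>R b + z *\<^sub>R c" for w k l z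
    by (auto simp: algebra_simps)
  then show ?thesis
    by (auto simp: span_insert span_singleton image_iff)
qed

lemma independent_orthogonal_three:
  fixes a b c :: "'a::real_inner"
  assumes "a \<bullet> b = 0" "a \<bullet> c = 0" "b \<bullet> c = 0" "a \<noteq> 0" "b \<noteq> 0" "c \<noteq> 0"
  shows "independent {a, b, c}" "card {a, b, c} = 3"
proof -
  show "independent {a, b, c}"
    by (rule pairwise_orthogonal_independent)
      (use assms in \<open>auto simp: pairwise_def orthogonal_def inner_commute\<close>)
  have "a \<noteq> b" "a \<noteq> c" "b \<noteq> c"
    using assms by auto
  then show "card {a, b, c} = 3"
    by simp
qed

section \<open>Coordinates on \<open>su2\<close>\<close>

text \<open>\<open>-\<i>/2\<close> times the combination of the Pauli matrices with coefficients \<open>x, y, z\<close>.\<close>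

definition su2_mat :: "real \<Rightarrow> real \<Rightarrow> real \<Rightarrow> complex^2^2" where
  "su2_mat x y z = vector [vector [Complex 0 (- z/2), Complex (- y/2) (- x/2)],
                           vector [Complex (y/2) (- x/2), Complex 0 (z/2)]]"

lemma su2_mat_add: "su2_mat (x + x') (y + y') (z + z') = su2_mat x y z + su2_mat x' y' z'"
  by (simp add: su2_mat_def vec_eq_iff forall_2 complex_eq_iff field_simps)

lemma su2_mat_scaleR: "su2_mat (r * x) (r * y) (r * z) = r *\<^sub>R su2_mat x y z"
  by (simp add: su2_mat_def vec_eq_iff forall_2 complex_eq_iff)

lemma su2_mat_eq_iff: "su2_mat x y z = su2_mat x' y' z' \<longleftrightarrow> x = x' \<and> y = y' \<and> z = z'"
  by (auto simp: su2_mat_def vec_eq_iff forall_2 complex_eq_iff)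

text \<open>The factor 1/2 in \<open>su2_mat\<close> absorbs the 2 in the commutators of the Pauli
  matrices, leaving exactly the cross product.\<close>

lemma commutator_su2_mat:
  "commutator (su2_mat x y z) (su2_mat x' y' z') =
     su2_mat (y * z' - z * y') (z * x' - x * z') (x * y' - y * x')"
  by (simp add: commutator_def su2_mat_def matrix_matrix_mult_def vec_eq_iff forall_2 sum_2
      complex_eq_iff field_simps)

lemma su2_eq: "su2 = {su2_mat x y z |x y z. True}"
proof (intro equalityI subsetI)
  fix A assume "A \<in> su2"
  then have adj: "cnj (A $ j $ i) = - A $ i $ j" and tr: "A $ 1 $ 1 + A $ 2 $ 2 = 0" for i j
    by (simp_all add: su2_def conj_transpose_def trace_def vec_eq_iff sum_2)
  have "A $ 2 $ 1 = - cnj (A $ 1 $ 2)" "Re (A $ 1 $ 1) = 0" "A $ 2 $ 2 = - A $ 1 $ 1"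
    using adj[of 1 1] adj[of 2 1] tr by (simp_all add: complex_eq_iff add_eq_0_iff)
  \<comment> \<open>The coordinates are read off the first row; skewness and zero trace determine
    the second.\<close>
  then have "A = su2_mat (- 2 * Im (A $ 1 $ 2)) (- 2 * Re (A $ 1 $ 2)) (- 2 * Im (A $ 1 $ 1))"
    by (simp add: su2_mat_def vec_eq_iff forall_2 complex_eq_iff)
  then show "A \<in> {su2_mat x y z |x y z. True}"
    by blast
next
  fix A assume "A \<in> {su2_mat x y z |x y z. True}"
  then show "A \<in> su2"
    by (auto simp: su2_def conj_transpose_def trace_def su2_mat_def vec_eq_iff forall_2 sum_2
        complex_eq_iff)
qed

section \<open>Bracket identities and recognition of su(2)\<close>

lemma lie_bracket_anticommute: "lie_bracket br \<Longrightarrow> br x y = - br y x"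
proof -
  assume br: "lie_bracket br"
  then have "bilinear br" "br (x + y) (x + y) = 0" "br x x = 0" "br y y = 0"
    by (auto simp: lie_bracket_def)
  then show ?thesis
    by (simp add: bilinear_ladd bilinear_radd add_eq_0_iff)
qed

lemma lie_isomorphic_su2:
  fixes a b c :: "'a::real_inner"
  assumes br: "lie_bracket br"
    and orth: "a \<bullet> b = 0" "a \<bullet> c = 0" "b \<bullet> c = 0"
    and nz: "a \<noteq> 0" "b \<noteq> 0" "c \<noteq> 0"
    and brs: "br a b = c" "br b c = a" "br c a = b"
  shows "lie_isomorphic br (span {a, b, c}) commutator su2"
proof -
  have bl: "bilinear br" and self: "\<And>x. br x x = 0"
    using br by (auto simp: lie_bracket_def)
  have anti: "br b a = - c" "br c b = - a" "br a c = - b"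
    using lie_bracket_anticommute[OF br] brs by metis+
  \<comment> \<open>Coordinates along orthogonal vectors that need not be unit. Defining them by
    inner products makes linearity immediate.\<close>
  define f where "f w = su2_mat (w \<bullet> a / (a \<bullet> a)) (w \<bullet> b / (b \<bullet> b)) (w \<bullet> c / (c \<bullet> c))" for w
  have f: "f (x *\<^sub>R a + y *\<^sub>R b + z *\<^sub>R c) = su2_mat x y z" for x y z
    using orth nz by (simp add: f_def inner_add_left inner_commute[of b a] inner_commute[of c a]
        inner_commute[of c b])
  have "lie_isomorphism br (span {a, b, c}) commutator su2 f"
    unfolding lie_isomorphism_def
  proof (intro conjI ballI allI)
    show "bij_betw f (span {a, b, c}) su2"
      unfolding bij_betw_def
    proof
      show "inj_on f (span {a, b, c})"
        by (rule inj_onI) (auto simp: span_three f su2_mat_eq_iff)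
      show "f ` span {a, b, c} = su2"
        unfolding span_three su2_eq by (force simp: f image_iff)
    qed
  next
    fix v w
    show "f (v + w) = f v + f w"
      by (simp add: f_def inner_add_left add_divide_distrib su2_mat_add)
  next
    fix r v
    show "f (r *\<^sub>R v) = r *\<^sub>R f v"
      by (simp add: f_def flip: su2_mat_scaleR)
  next
    fix v w assume "v \<in> span {a, b, c}" "w \<in> span {a, b, c}"
    then obtain x y z x' y' z' where v: "v = x *\<^sub>R a + y *\<^sub>R b + z *\<^sub>R c"
      and w: "w = x' *\<^sub>R a + y' *\<^sub>R b + z' *\<^sub>R c"
      unfolding span_three by blast
    have "br v w = (y * z' - z * y') *\<^sub>R a + (z * x' - x * z') *\<^sub>R b + (x * y' - y * x') *\<^sub>R c"
      by (simp add: v w bilinear_ladd[OF bl] bilinear_radd[OF bl] bilinear_lmul[OF bl]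
          bilinear_rmul[OF bl] brs anti self algebra_simps)
    then show "f (br v w) = commutator (f v) (f w)"
      by (simp add: f v w commutator_su2_mat)
  qed
  then show ?thesis
    unfolding lie_isomorphic_def by blast
qed

text \<open>Invariance and antisymmetry make every \<open>br x\<close> skew-adjoint. The last
  identity is the third with \<open>x\<close> and \<open>y\<close> exchanged.\<close>

lemma invariant_inner_bracket:
  assumes br: "lie_bracket br" and inv: "invariant_inner br"
  shows "br x y \<bullet> x = 0" "br x y \<bullet> y = 0"
    and "br x (br x y) \<bullet> y = - (br x y \<bullet> br x y)"
    and "br y (br x y) \<bullet> x = br x y \<bullet> br x y"
proof -
  have bl: "bilinear br" and self: "\<And>x. br x x = 0"
    using br by (auto simp: lie_bracket_def)
  have I: "br x y \<bullet> z = x \<bullet> br y z" for x y z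
    using inv by (auto simp: invariant_inner_def)
  have anti: "br x y = - br y x" for x y
    by (rule lie_bracket_anticommute[OF br])
  show *: "br x y \<bullet> y = 0" for x y
    by (simp add: I self)
  show "br x y \<bullet> x = 0"
    by (subst anti) (simp add: *)
  show **: "br x (br x y) \<bullet> y = - (br x y \<bullet> br x y)" for x y
    by (subst anti) (simp add: I)
  show "br y (br x y) \<bullet> x = br x y \<bullet> br x y"
    by (metis ** anti inner_commute inner_minus_left I)
qed

lemma su2_bracket_span:
  assumes br: "lie_bracket br" and inv: "invariant_inner br"
    and ab: "a \<bullet> b = 0" and nz: "br a b \<noteq> 0"
    and ac: "br a (br a b) = - p *\<^sub>R b" and bc: "br b (br a b) = q *\<^sub>R a"
    and pq: "p > 0" "q > 0"
  shows "lie_subalgebra br (span {a, b, br a b})"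
    and "lie_isomorphic br (span {a, b, br a b}) commutator su2"
proof -
  have bl: "bilinear br" and self: "\<And>x. br x x = 0"
    using br by (auto simp: lie_bracket_def)
  let ?c = "br a b" and ?S = "span {a, b, br a b}"
  \<comment> \<open>The scalings are forced: \<open>br c' a' = b'\<close> requires
    \<open>s * s = p\<close>, \<open>br b' c' = a'\<close> requires \<open>t * t = q\<close>, and
    \<open>br a' b' = c'\<close> then fixes \<open>c'\<close>. Positivity of \<open>p\<close> and
    \<open>q\<close> provides real roots.\<close>
  define s t where "s = sqrt p" and "t = sqrt q"
  then have st: "s \<noteq> 0" "t \<noteq> 0" "p = s * s" "q = t * t"
    using pq by simp_all
  define a' b' c' where "a' = (1 / s) *\<^sub>R a" and "b' = (1 / t) *\<^sub>R b"
    and "c' = (1 / (s * t)) *\<^sub>R ?c"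
  note anti = lie_bracket_anticommute[OF br]
  have ba: "br b a = - ?c" and ca: "br ?c a = p *\<^sub>R b" and cb: "br ?c b = - q *\<^sub>R a"
    using anti[of b a] anti[of ?c a] anti[of ?c b] ac bc by auto
  have "a \<in> ?S" "b \<in> ?S" "?c \<in> ?S"
    by (simp_all add: span_base)
  then have gen: "br x y \<in> ?S" if "x \<in> {a, b, ?c}" "y \<in> {a, b, ?c}" for x y
    using that by (auto simp: self ac bc ba ca cb span_neg span_scale span_zero)
  show "lie_subalgebra br ?S"
    using bilinear_span_closed[OF bl gen] by (simp add: lie_subalgebra_def)
  have "a \<noteq> 0" "b \<noteq> 0"
    using nz bilinear_lzero[OF bl] bilinear_rzero[OF bl] by auto
  have eqs: "a = s *\<^sub>R a'" "b = t *\<^sub>R b'" "?c = (s * t) *\<^sub>R c'"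
    using st by (simp_all add: a'_def b'_def c'_def)
  have "s *\<^sub>R a' \<in> span {a', b', c'}" "t *\<^sub>R b' \<in> span {a', b', c'}"
    "(s * t) *\<^sub>R c' \<in> span {a', b', c'}"
    by (simp_all add: span_base span_scale)
  then have "{a, b, ?c} \<subseteq> span {a', b', c'}"
    by (simp flip: eqs)
  moreover have "{a', b', c'} \<subseteq> ?S"
    by (auto simp: a'_def b'_def c'_def intro: span_scale span_base)
  ultimately have "span {a', b', c'} = ?S"
    by (simp add: span_eq)
  moreover have "lie_isomorphic br (span {a', b', c'}) commutator su2"
  proof (rule lie_isomorphic_su2[OF br])
    show "a' \<bullet> b' = 0" "a' \<bullet> c' = 0" "b' \<bullet> c' = 0"
      using ab invariant_inner_bracket[OF br inv]
      by (simp_all add: a'_def b'_def c'_def inner_commute)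
    show "a' \<noteq> 0" "b' \<noteq> 0" "c' \<noteq> 0"
      using \<open>a \<noteq> 0\<close> \<open>b \<noteq> 0\<close> nz st by (simp_all add: a'_def b'_def c'_def)
    show "br a' b' = c'" "br b' c' = a'" "br c' a' = b'"
      using st(1,2)
      by (simp_all add: a'_def b'_def c'_def bilinear_lmul[OF bl] bilinear_rmul[OF bl] ca bc st(3,4))
  qed
  ultimately show "lie_isomorphic br ?S commutator su2"
    by simp
qed

theorem lemma6p3:
  fixes br :: "'a::real_inner \<Rightarrow> 'a \<Rightarrow> 'a" and \<sigma> :: "'a \<Rightarrow> 'a" and Z :: 'a
  assumes "finite_dimensional (UNIV :: 'a set)"
    and "lie_bracket br"
    and "invariant_inner br"
    and "lie_isomorphism br UNIV br UNIV \<sigma>"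
    and "orthogonal_transformation \<sigma>"
    and "\<sigma> \<circ> \<sigma> = id"
  shows "H8 br \<sigma> Z \<ge> 0
    \<and> (H8 br \<sigma> Z = 0 \<longleftrightarrow> dim (lie_gen br {Z, \<sigma> Z}) \<le> 3)
    \<and> (C_mid br \<sigma> Z = 0 \<longrightarrow>
         lie_gen br {Z, \<sigma> Z} = span {A_plus \<sigma> Z, A_minus \<sigma> Z}
         \<and> lie_abelian br (lie_gen br {Z, \<sigma> Z}))
    \<and> (C_mid br \<sigma> Z \<noteq> 0 \<and> H8 br \<sigma> Z = 0 \<longrightarrow>
         lie_gen br {Z, \<sigma> Z} = span {A_plus \<sigma> Z, A_minus \<sigma> Z, C_mid br \<sigma> Z}
         \<and> lie_isomorphic br (lie_gen br {Z, \<sigma> Z}) commutator su2)"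
proof -
  note br = assms(2) and inv = assms(3)
  have bl: "bilinear br" and self: "\<And>x. br x x = 0"
    using br by (auto simp: lie_bracket_def)
  define a b c where "a = A_plus \<sigma> Z" and "b = A_minus \<sigma> Z" and "c = br a b"
  define L where "L = lie_gen br {Z, \<sigma> Z}"
  define P Q where "P = (br a c \<bullet> br a c) * (b \<bullet> b) - (br a c \<bullet> b)\<^sup>2"
    and "Q = (br b c \<bullet> br b c) * (a \<bullet> a) - (br b c \<bullet> a)\<^sup>2"
  have "\<sigma> (\<sigma> Z) = Z"
    using assms(6) by (metis comp_apply id_apply)
  then have "\<sigma> Z \<bullet> \<sigma> Z = Z \<bullet> Z"
    using assms(5) by (auto simp: orthogonal_transformation_def)
  \<comment> \<open>Up to a factor 1/4, \<open>a \<bullet> b\<close> is the difference of the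
    squared norms of \<open>Z\<close> and \<open>\<sigma> Z\<close>.\<close>
  then have ab: "a \<bullet> b = 0"
    by (simp add: a_def b_def A_plus_def A_minus_def inner_add_left inner_diff_right
        inner_commute[of "\<sigma> Z" Z])
  have Z: "Z = a + b" "\<sigma> Z = a - b"
    by (simp_all add: a_def b_def A_plus_def A_minus_def algebra_simps flip: scaleR_add_left)
  note ip = invariant_inner_bracket[OF br inv, where x = a and y = b, folded c_def]
  have c_orth: "a \<bullet> c = 0" "b \<bullet> c = 0"
    using ip(1,2) by (simp_all add: inner_commute)
  have "P \<ge> 0" "Q \<ge> 0"
    unfolding P_def Q_def using Cauchy_Schwarz_ineq[of "br a c" b] Cauchy_Schwarz_ineq[of "br b c" a]
    by simp_all
  \<comment> \<open>By \<open>ip(3,4)\<close> the squares subtracted in \<open>P\<close> and in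
    \<open>Q\<close> both equal \<open>(c \<bullet> c)\<^sup>2\<close>, whence the coefficient 2 in
    \<open>H8\<close>.\<close>
  have "norm c ^ 4 = (c \<bullet> c)\<^sup>2"
    by (simp flip: power2_norm_eq_inner)
  then have H: "H8 br \<sigma> Z = P + Q"
    using ip(3,4)
    by (simp add: H8_def C_plus_def C_minus_def C_mid_def P_def Q_def power2_norm_eq_inner
        flip: a_def b_def c_def)
  have H0: "H8 br \<sigma> Z = 0 \<longleftrightarrow> P = 0 \<and> Q = 0"
    using H \<open>P \<ge> 0\<close> \<open>Q \<ge> 0\<close> by linarith
  have L: "lie_subalgebra br L" "Z \<in> L" "\<sigma> Z \<in> L"
    using lie_subalgebra_lie_gen lie_gen_superset unfolding L_def by blast+
  then have subL: "subspace L" and brL: "\<And>x y. x \<in> L \<Longrightarrow> y \<in> L \<Longrightarrow> br x y \<in> L"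
    by (auto simp: lie_subalgebra_def)
  have "a \<in> L" "b \<in> L"
    unfolding a_def b_def A_plus_def A_minus_def
    using L subL by (simp_all add: subspace_add subspace_diff subspace_scale)
  then have abcL: "a \<in> L" "b \<in> L" "c \<in> L"
    by (auto simp: c_def brL)
  \<comment> \<open>Used with \<open>B = {a, b}\<close> when \<open>c = 0\<close> and with
    \<open>B = {a, b, c}\<close> otherwise.\<close>
  have L_eq: "L = span B" if "lie_subalgebra br (span B)" "{a, b} \<subseteq> B" "B \<subseteq> {a, b, c}" for B
  proof
    have "a \<in> span B" "b \<in> span B"
      using that(2) by (auto intro: span_base)
    then have "{Z, \<sigma> Z} \<subseteq> span B"
      using span_add[of a B b] span_diff[of a B b] by (simp flip: Z)
    then show "L \<subseteq> span B"
      unfolding L_def using that(1) by (rule lie_gen_minimal)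
    show "span B \<subseteq> L"
      using that(3) abcL by (intro span_minimal subL) auto
  qed
  have abelian: "L = span {a, b}" "lie_abelian br L" if "c = 0"
  proof -
    have ba: "br a b = 0" "br b a = 0"
      using that lie_bracket_anticommute[OF br, of b a] by (simp_all add: c_def)
    have zero: "br v w = 0" if "v \<in> span {a, b}" "w \<in> span {a, b}" for v w
    proof -
      \<comment> \<open>Passing to the larger span gives access to the coordinates of
        \<open>span_three\<close>; the third term vanishes with \<open>c\<close>.\<close>
      have "v \<in> span {a, b, c}" "w \<in> span {a, b, c}"
        using that span_mono[of "{a, b}" "{a, b, c}"] by auto
      then show ?thesis
        by (auto simp: span_three \<open>c = 0\<close> bilinear_ladd[OF bl] bilinear_radd[OF bl]
            bilinear_lmul[OF bl] bilinear_rmul[OF bl] self ba)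
    qed
    show "L = span {a, b}"
      by (rule L_eq) (auto simp: lie_subalgebra_def zero span_zero)
    then show "lie_abelian br L"
      by (simp add: lie_abelian_def zero)
  qed
  have nz: "a \<noteq> 0" "b \<noteq> 0" if "c \<noteq> 0"
    using that bilinear_lzero[OF bl] bilinear_rzero[OF bl] by (auto simp: c_def)
  have su2: "L = span {a, b, c}" "lie_isomorphic br L commutator su2"
    if c: "c \<noteq> 0" and H_zero: "H8 br \<sigma> Z = 0"
  proof -
    have "P = 0" "Q = 0"
      using H_zero H0 by auto
    \<comment> \<open>Equality in Cauchy-Schwarz gives proportionality, and \<open>ip(3,4)\<close>
      gives the coefficients, whose signs match the positive \<open>p\<close> and \<open>q\<close>
      of \<open>su2_bracket_span\<close>.\<close>
    then have "br a c = - (c \<bullet> c / (b \<bullet> b)) *\<^sub>R b" "br b c = (c \<bullet> c / (a \<bullet> a)) *\<^sub>R a"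
      using Cauchy_Schwarz_equality_imp[of "br a c" b] Cauchy_Schwarz_equality_imp[of "br b c" a]
        nz[OF c] ip(3,4) by (simp_all add: P_def Q_def)
    moreover have "c \<bullet> c / (b \<bullet> b) > 0" "c \<bullet> c / (a \<bullet> a) > 0"
      using c nz by auto
    ultimately have *: "lie_subalgebra br (span {a, b, c})"
      "lie_isomorphic br (span {a, b, c}) commutator su2"
      using su2_bracket_span[OF br inv ab] c unfolding c_def by blast+
    show "L = span {a, b, c}"
      by (rule L_eq) (use * in auto)
    then show "lie_isomorphic br L commutator su2"
      using * by simp
  qed
  have H_zero: "P = 0" "Q = 0" if c: "c \<noteq> 0" and dim: "dim L \<le> 3"
  proof -
    \<comment> \<open>Three nonzero orthogonal vectors of \<open>L\<close> already exhaust the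
      allowed dimension.\<close>
    have "L = span {a, b, c}"
      using independent_orthogonal_three[OF ab c_orth nz[OF c] c] abcL dim
      by (intro independent_eq_span_of_dim_le[OF assms(1) subL]) auto
    then obtain x y z x' y' z' where *: "br a c = x *\<^sub>R a + y *\<^sub>R b + z *\<^sub>R c"
      "br b c = x' *\<^sub>R a + y' *\<^sub>R b + z' *\<^sub>R c"
      using brL[OF abcL(1,3)] brL[OF abcL(2,3)] unfolding span_three by blast
    \<comment> \<open>\<open>br a c\<close> is orthogonal to \<open>a\<close> and \<open>c\<close>,
      and \<open>br b c\<close> to \<open>b\<close> and \<open>c\<close>, so one coefficient
      survives in each expansion. Proportional vectors have zero defect.\<close>
    note ic = invariant_inner_bracket(1,2)[OF br inv, where x = a and y = c]
      invariant_inner_bracket(1,2)[OF br inv, where x = b and y = c]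
    have "x = 0" "z = 0" "y' = 0" "z' = 0"
      using ic nz[OF c] c ab c_orth unfolding *
      by (simp_all add: inner_add_left inner_commute[of b a] inner_commute[of c a]
          inner_commute[of c b])
    then show "P = 0" "Q = 0"
      using * by (simp_all add: P_def Q_def power2_eq_square)
  qed
  have dim_L: "dim L \<le> 3" if "H8 br \<sigma> Z = 0"
  proof -
    \<comment> \<open>This covers both cases, as a zero \<open>c\<close> adds nothing to the span.
      Bounding the cardinality allows for coinciding vectors.\<close>
    have "L = span {a, b, c}"
      using abelian(1) su2(1)[OF _ that] by (cases "c = 0") (auto simp: insert_commute)
    then have "dim L \<le> card {a, b, c}"
      by (simp add: dim_le_card')
    then show ?thesis
      using card_insert_le_m1[of 3 "{b, c}" a] card_insert_le_m1[of 2 "{c}" b] by simp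
  qed
  have "H8 br \<sigma> Z = 0 \<longleftrightarrow> dim L \<le> 3"
  proof (cases "c = 0")
    case True
    \<comment> \<open>With \<open>c = 0\<close> both sides of the equivalence are true.\<close>
    then have "P = 0" "Q = 0"
      by (simp_all add: P_def Q_def bilinear_rzero[OF bl])
    then show ?thesis
      using H0 dim_L by blast
  next
    case False
    then show ?thesis
      using H0 H_zero dim_L by blast
  qed
  moreover have "H8 br \<sigma> Z \<ge> 0"
    using H \<open>P \<ge> 0\<close> \<open>Q \<ge> 0\<close> by simp
  moreover have "C_mid br \<sigma> Z = c"
    by (simp add: C_mid_def a_def b_def c_def)
  ultimately show ?thesis
    using abelian su2 by (simp flip: a_def b_def L_def)
qed

end
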